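(* For any constant $0<\varepsilon<1/3$, any randomized algorithm that outputs a $(2-\varepsilon)$-approximate Steiner Tree performs at least $\Omega(nk)$ queries in the worst case.
   Context: An instance of the metric Steiner Tree problem is a triple $(V,T,w)$ where $V$ is a set of $n$ points, $T\subseteq V$ is a set of $k$ terminals, and $w$ is a metric on $V$. A Steiner tree is a tree whose vertices are points of $V$ and which contains all points of $T$; its cost is the sum of $w(u,v)$ over its edges $(u,v)$. ${\mathsf{ST}}(V,T,w)$ denotes the minimum cost of a Steiner tree. A $\beta$-approximate Steiner tree is a Steiner tree of cost at most $\beta\cdot{\mathsf{ST}}(V,T,w)$. An algorithm knows $V$ and $T$ but can access $w$ only through queries: a query specifies a pair $u,v\in V$ and returns $w(u,v)$. The query complexity is the number of queries performed. *)

theory Defs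
  imports "HOL-Probability.Probability"
begin

text \<open>
  A finite simple undirected graph is a vertex set together with a symmetric, irreflexive
  adjacency relation: the undirected edge between \<open>u\<close> and \<open>v\<close> is the pair of pairs
  \<open>(u, v)\<close> and \<open>(v, u)\<close>.
\<close>

type_synonym 'a graph = "'a set \<times> ('a \<times> 'a) set"

definition simple_graph :: "'a graph \<Rightarrow> bool" where
  "simple_graph G \<longleftrightarrow> finite (fst G) \<and> snd G \<subseteq> fst G \<times> fst G \<and> sym (snd G) \<and> irrefl (snd G)"

definition connected_graph :: "'a graph \<Rightarrow> bool" where
  "connected_graph G \<longleftrightarrow> fst G \<noteq> {} \<and> (\<forall>u\<in>fst G. \<forall>v\<in>fst G. (u, v) \<in> (snd G)\<^sup>*)"

definition is_cycle :: "'a graph \<Rightarrow> 'a list \<Rightarrow> bool" where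
  "is_cycle G c \<longleftrightarrow> 3 \<le> length c \<and> distinct c \<and>
     (\<forall>i<length c. (c ! i, c ! (Suc i mod length c)) \<in> snd G)"

definition is_tree :: "'a graph \<Rightarrow> bool" where
  "is_tree G \<longleftrightarrow> simple_graph G \<and> connected_graph G \<and> (\<nexists>c. is_cycle G c)"

definition steiner_tree :: "'a set \<Rightarrow> 'a set \<Rightarrow> 'a graph \<Rightarrow> bool" where
  "steiner_tree V T G \<longleftrightarrow> is_tree G \<and> T \<subseteq> fst G \<and> fst G \<subseteq> V"

text \<open>
  The factor \<open>1/2\<close> compensates for every undirected edge occurring in both orientations; it is
  only meaningful for symmetric weights.
\<close>

definition cost :: "('a \<Rightarrow> 'a \<Rightarrow> real) \<Rightarrow> 'a graph \<Rightarrow> real" where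
  "cost w G = (\<Sum>(u, v)\<in>snd G. w u v) / 2"

text \<open>
  For finite \<open>V\<close> and nonempty \<open>T \<subseteq> V\<close> the set below is finite and nonempty, so that \<^const>\<open>Min\<close>
  is a genuine minimum.
\<close>

definition ST :: "'a set \<Rightarrow> 'a set \<Rightarrow> ('a \<Rightarrow> 'a \<Rightarrow> real) \<Rightarrow> real" where
  "ST V T w = Min (cost w ` {G. steiner_tree V T G})"

definition approx_steiner_tree ::
    "real \<Rightarrow> 'a set \<Rightarrow> 'a set \<Rightarrow> ('a \<Rightarrow> 'a \<Rightarrow> real) \<Rightarrow> 'a graph \<Rightarrow> bool" where
  "approx_steiner_tree \<beta> V T w G \<longleftrightarrow> steiner_tree V T G \<and> cost w G \<le> \<beta> * ST V T w"

text \<open>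
  A deterministic adaptive query algorithm is a decision tree: it either stops with an output
  graph, or queries a pair of points and continues depending on the real number returned.
  It may depend arbitrarily on \<open>V\<close> and \<open>T\<close>, and computation between queries is free.
\<close>

datatype 'a algorithm =
    Output "'a graph"
  | Query 'a 'a "real \<Rightarrow> 'a algorithm"

primrec queries_within :: "'a set \<Rightarrow> 'a algorithm \<Rightarrow> bool" where
  "queries_within V (Output G) \<longleftrightarrow> True"
| "queries_within V (Query u v f) \<longleftrightarrow> u \<in> V \<and> v \<in> V \<and> (\<forall>x. queries_within V (f x))"

primrec alg_output :: "('a \<Rightarrow> 'a \<Rightarrow> real) \<Rightarrow> 'a algorithm \<Rightarrow> 'a graph" where
  "alg_output w (Output G) = G"
| "alg_output w (Query u v f) = alg_output w (f (w u v))"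

primrec num_queries :: "('a \<Rightarrow> 'a \<Rightarrow> real) \<Rightarrow> 'a algorithm \<Rightarrow> nat" where
  "num_queries w (Output G) = 0"
| "num_queries w (Query u v f) = Suc (num_queries w (f (w u v)))"

text \<open>
  A randomized algorithm is a probability distribution over deterministic ones, not necessarily
  discrete, such that on every fixed metric the output and the number of queries are random
  variables.
\<close>

definition randomized_algorithm :: "'a set \<Rightarrow> 'a algorithm measure \<Rightarrow> bool" where
  "randomized_algorithm V R \<longleftrightarrow> prob_space R \<and> (\<forall>A\<in>space R. queries_within V A) \<and>
     (\<forall>w. Metric_space V w \<longrightarrow>
        (\<lambda>A. (alg_output w A, num_queries w A)) \<in> measurable R (count_space UNIV))"

definition computes_approx_steiner_tree ::
    "real \<Rightarrow> real \<Rightarrow> 'a set \<Rightarrow> 'a set \<Rightarrow> 'a algorithm measure \<Rightarrow> bool" where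
  "computes_approx_steiner_tree p \<beta> V T R \<longleftrightarrow>
     (\<forall>w. Metric_space V w \<longrightarrow>
        p \<le> measure R {A \<in> space R. approx_steiner_tree \<beta> V T w (alg_output w A)})"

text \<open>Worst case over the input metric as well as over the random choices of the algorithm.\<close>

definition worst_case_queries_ge :: "'a set \<Rightarrow> 'a algorithm measure \<Rightarrow> real \<Rightarrow> bool" where
  "worst_case_queries_ge V R q \<longleftrightarrow>
     (\<exists>w. Metric_space V w \<and> 0 < measure R {A \<in> space R. q \<le> real (num_queries w A)})"

end

theory Submission
  imports Defs
begin

text \<open>
  Split the terminals into publicly known groups of at most \<open>D = O(1 / \<epsilon>)\<close> elements, and hide for
  every group an independent uniformly random centre in \<open>V\<close>. A terminal has distance 1 to the
  centre of its group and all other distances are 2. Joining the terminals to their centres shows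
  \<open>ST \<le> k + O(\<epsilon> k)\<close>, whereas a tree costs about \<open>2 k\<close> unless it contains \<open>\<Omega>(\<epsilon> k)\<close> edges of
  length 1, that is, unless a constant fraction of the centres has been found. Resampling a single
  centre shows that a group with \<open>N\<close> expected probes is found with probability at most \<open>2 N / n\<close>, so
  with \<open>c n k\<close> queries, \<open>c\<close> small, only a small fraction of the centres is found on average. Averaging over
  the centres and over the coins of the algorithm gives the bound for randomized algorithms.
\<close>

section \<open>Trees and connected graphs\<close>

text \<open>Every vertex other than a root \<open>r\<close> chooses a neighbour strictly closer to
  \<open>r\<close>. These parent edges are distinct, and each is present in both orientations,
  whence the factor 2.\<close>

lemma connected_graph_card_edges:
  assumes G: "simple_graph G" "connected_graph G"
  shows "2 * (card (fst G) - 1) \<le> card (snd G)"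
proof -
  define W where "W = fst G"
  define E where "E = snd G"
  have fin: "finite W" and EW: "E \<subseteq> W \<times> W" and sy: "sym E"
    using G by (auto simp: simple_graph_def W_def E_def)
  have finE: "finite E" using fin EW by (meson finite_SigmaI finite_subset)
  obtain r where r: "r \<in> W" using G by (auto simp: connected_graph_def W_def)
  define d where "d v = (LEAST n. (r, v) \<in> E ^^ n)" for v
  have par: "\<exists>u. (v, u) \<in> E \<and> d u < d v" if v: "v \<in> W - {r}" for v
  proof -
    have "(r, v) \<in> E\<^sup>*" using G r v by (auto simp: connected_graph_def W_def E_def)
    then have "\<exists>n. (r, v) \<in> E ^^ n" by (rule rtrancl_imp_relpow)
    then have dv: "(r, v) \<in> E ^^ d v" unfolding d_def by (rule LeastI_ex)
    have "d v \<noteq> 0" using dv v by (intro notI) auto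
    then obtain j where j: "d v = Suc j" using not0_implies_Suc by blast
    then obtain u where u: "(r, u) \<in> E ^^ j" "(u, v) \<in> E" using dv by auto
    have "d u \<le> j" unfolding d_def using u(1) by (rule Least_le)
    then show ?thesis using u(2) j sy by (auto dest: symD)
  qed
  then obtain f where f: "(v, f v) \<in> E" "d (f v) < d v" if "v \<in> W - {r}" for v
    by metis
  let ?A = "(\<lambda>v. (v, f v)) ` (W - {r})" and ?B = "(\<lambda>v. (f v, v)) ` (W - {r})"
  have cA: "card ?A = card W - 1" and cB: "card ?B = card W - 1"
    using r fin by (auto simp: card_image inj_on_def)
  \<comment> \<open>A common element would make two vertices parents of each other, although
    \<open>d\<close> drops strictly along each parent edge.\<close>
  have "?A \<inter> ?B = {}"
  proof (rule equals0I)
    fix e assume "e \<in> ?A \<inter> ?B"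
    then obtain u v where "u \<in> W - {r}" "v \<in> W - {r}" "e = (v, f v)" "e = (f u, u)" by blast
    then have "f v = u" "f u = v" by auto
    then show False using f(2)[OF \<open>u \<in> W - {r}\<close>] f(2)[OF \<open>v \<in> W - {r}\<close>] by simp
  qed
  then have "card (?A \<union> ?B) = 2 * (card W - 1)"
    using cA cB fin by (subst card_Un_disjoint) auto
  moreover have "?A \<union> ?B \<subseteq> E" using f(1) sy by (auto dest: symD)
  ultimately have "2 * (card W - 1) \<le> card E" using card_mono[OF finE] by metis
  then show ?thesis by (simp add: W_def E_def)
qed

lemma is_tree_singleton: "is_tree ({x}, {})"
proof -
  have "\<not> is_cycle ({x}, {}) c" for c by (cases c) (auto simp: is_cycle_def)
  then show ?thesis
    by (auto simp: is_tree_def simple_graph_def connected_graph_def sym_def irrefl_def)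
qed

text \<open>The cyclic predecessor and successor of a vertex differ because a cycle has length at
  least 3. This excludes cycles through a leaf.\<close>

lemma is_cycle_neighbours:
  assumes c: "is_cycle G c" and x: "x \<in> set c"
  obtains y z where "y \<noteq> z" "(x, y) \<in> snd G" "(z, x) \<in> snd G" "y \<in> set c" "z \<in> set c"
proof -
  let ?n = "length c"
  have n: "3 \<le> ?n" and dc: "distinct c" using c by (auto simp: is_cycle_def)
  have e: "(c ! i, c ! (Suc i mod ?n)) \<in> snd G" if "i < ?n" for i
    using c that by (auto simp: is_cycle_def)
  obtain i where i: "i < ?n" "c ! i = x" using x by (auto simp: in_set_conv_nth)
  define s where "s = (if Suc i = ?n then 0 else Suc i)"
  define p where "p = (if i = 0 then ?n - 1 else i - 1)"
  have p: "p < ?n" and s: "s < ?n" and "s \<noteq> p" using i(1) n by (auto simp: p_def s_def)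
  have ss: "Suc i mod ?n = s" using i(1) by (auto simp: s_def)
  have sp: "Suc p mod ?n = i"
  proof (cases "i = 0")
    case True
    then have "Suc p = ?n" using n by (simp add: p_def)
    then show ?thesis using True by simp
  next
    case False
    then have "Suc p = i" by (simp add: p_def)
    then show ?thesis using i(1) by simp
  qed
  have "c ! s \<noteq> c ! p" using \<open>s \<noteq> p\<close> dc s p by (simp add: nth_eq_iff_index_eq)
  then show thesis using that[of "c ! s" "c ! p"] e[OF i(1)] e[OF p] nth_mem[OF s] nth_mem[OF p]
    unfolding sp ss i(2) by blast
qed

text \<open>A cycle through \<open>x\<close> would need two different neighbours of
  \<open>x\<close>, but \<open>v\<close> is the only one; a cycle avoiding \<open>x\<close> already
  lies in \<open>E\<close>.\<close>

lemma is_tree_add_leaf: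
  assumes t: "is_tree (W, E)" and v: "v \<in> W" and x: "x \<notin> W"
  shows "is_tree (insert x W, insert (x, v) (insert (v, x) E))" (is "is_tree (?W, ?E)")
proof -
  have s: "finite W" "E \<subseteq> W \<times> W" "sym E" "irrefl E" and
    con: "\<And>a b. a \<in> W \<Longrightarrow> b \<in> W \<Longrightarrow> (a, b) \<in> E\<^sup>*" and nc: "\<And>c. \<not> is_cycle (W, E) c"
    using t by (auto simp: is_tree_def simple_graph_def connected_graph_def)
  have "simple_graph (?W, ?E)"
    using s v x by (auto simp: simple_graph_def sym_def irrefl_def)
  moreover have "connected_graph (?W, ?E)"
  proof -
    have E: "(a, b) \<in> ?E\<^sup>*" if "a \<in> W" "b \<in> W" for a b
      using con[OF that] by (rule rtrancl_mono[THEN subsetD, rotated]) auto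
    have xv: "(x, v) \<in> ?E" "(v, x) \<in> ?E" by auto
    have "(a, v) \<in> ?E\<^sup>*" "(v, a) \<in> ?E\<^sup>*" if "a \<in> ?W" for a
      using that E v xv by (auto intro: r_into_rtrancl)
    then show ?thesis unfolding connected_graph_def by (auto intro: rtrancl_trans)
  qed
  moreover have "\<not> is_cycle (?W, ?E) c" for c
  proof
    assume c: "is_cycle (?W, ?E) c"
    show False
    proof (cases "x \<in> set c")
      case True
      then obtain y z where "y \<noteq> z" "(x, y) \<in> ?E" "(z, x) \<in> ?E"
        using is_cycle_neighbours[OF c] by (metis snd_conv)
      then show False using s(2) v x by auto
    next
      case False
      have "(c ! i, c ! (Suc i mod length c)) \<in> E" if i: "i < length c" for i
      proof -
        have "c ! i \<in> set c" "c ! (Suc i mod length c) \<in> set c"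
          using i by (auto intro!: nth_mem mod_less_divisor)
        moreover have "(c ! i, c ! (Suc i mod length c)) \<in> ?E"
          using c i by (auto simp: is_cycle_def)
        ultimately show ?thesis using False by auto
      qed
      then have "is_cycle (W, E) c" using c by (auto simp: is_cycle_def)
      then show False using nc by blast
    qed
  qed
  ultimately show ?thesis by (auto simp: is_tree_def)
qed

lemma cost_add_leaf:
  assumes "is_tree (W, E)" and "v \<in> W" and x: "x \<notin> W" and "w x v = w v x"
  shows "cost w (insert x W, insert (x, v) (insert (v, x) E)) = cost w (W, E) + w v x"
proof -
  have "finite W" "E \<subseteq> W \<times> W" using assms by (auto simp: is_tree_def simple_graph_def)
  moreover from this have "finite E" by (meson finite_SigmaI finite_subset)
  moreover from \<open>E \<subseteq> W \<times> W\<close> have "(x, v) \<notin> E" "(v, x) \<notin> E" "x \<noteq> v" using assms by auto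
  ultimately show ?thesis using assms by (simp add: cost_def field_simps)
qed

text \<open>The elements of \<open>X\<close> are attached one by one as leaves. All attachment
  points lie in the initial \<open>W\<close>, so the order is irrelevant; elements already present
  are charged \<open>b\<close> as well.\<close>

lemma tree_extend:
  assumes t: "is_tree (W, E)" and X: "finite X"
    and r: "\<And>x. x \<in> X \<Longrightarrow> r x \<in> W" "\<And>x. x \<in> X \<Longrightarrow> x \<noteq> r x \<Longrightarrow> w (r x) x \<le> b" "0 \<le> b"
    and sym: "\<And>x y. w x y = w y x"
  shows "\<exists>F. is_tree (W \<union> X, F) \<and> cost w (W \<union> X, F) \<le> cost w (W, E) + b * card X"
  using X r(1,2)
proof (induction X rule: finite_induct)
  case empty
  then show ?case using t by auto
next
  case (insert x X)
  then obtain F where F: "is_tree (W \<union> X, F)"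
    "cost w (W \<union> X, F) \<le> cost w (W, E) + b * card X" by auto
  show ?case
  proof (cases "x \<in> W \<union> X")
    case True
    then have "W \<union> insert x X = W \<union> X" by auto
    moreover have "b * card X \<le> b * card (insert x X)"
      using r(3) insert(1,2) by (simp add: mult_left_mono)
    ultimately show ?thesis using F by (intro exI[of _ F]) auto
  next
    case False
    have "r x \<in> W" using insert.prems(1)[of x] by simp
    moreover from this have "x \<noteq> r x" using False by auto
    ultimately have rx: "r x \<in> W \<union> X" "w (r x) x \<le> b" using insert.prems(2)[of x] by auto
    let ?F = "insert (x, r x) (insert (r x, x) F)"
    have "is_tree (W \<union> insert x X, ?F)" using is_tree_add_leaf[OF F(1) rx(1) False] by simp
    moreover have "cost w (W \<union> insert x X, ?F) \<le> cost w (W, E) + b * card (insert x X)"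
      using cost_add_leaf[OF F(1) rx(1) False, of w, OF sym] F(2) rx(2) insert(1,2)
      by (simp add: algebra_simps)
    ultimately show ?thesis by blast
  qed
qed

lemma ST_le:
  assumes "finite V" "steiner_tree V T G"
  shows "ST V T w \<le> cost w G"
proof -
  have "{G. steiner_tree V T G} \<subseteq> Pow V \<times> Pow (V \<times> V)"
    by (force simp: steiner_tree_def is_tree_def simple_graph_def)
  then have "finite {G. steiner_tree V T G}"
    using assms(1) by (meson finite_Pow_iff finite_SigmaI finite_subset)
  then show ?thesis unfolding ST_def using assms(2) by (intro Min_le) auto
qed

section \<open>Metrics with hidden centres\<close>

text \<open>The zero case comes first because a terminal may itself be the centre of its group.
  Different groups may share a centre.\<close>

definition hidden_dist :: "'a set \<Rightarrow> ('a \<Rightarrow> nat) \<Rightarrow> (nat \<Rightarrow> 'a) \<Rightarrow> 'a \<Rightarrow> 'a \<Rightarrow> real" where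
  "hidden_dist T gr c u v =
     (if u = v then 0
      else if u \<in> T \<and> c (gr u) = v \<or> v \<in> T \<and> c (gr v) = u then 1 else 2)"

lemma hidden_dist_commute: "hidden_dist T gr c u v = hidden_dist T gr c v u"
  by (auto simp: hidden_dist_def)

text \<open>Distinct points have distance 1 or 2, and two distances of at least 1 add up to the
  maximum 2.\<close>

lemma Metric_space_hidden_dist: "Metric_space V (hidden_dist T gr c)"
proof
  fix x y z
  have "hidden_dist T gr c x z \<le> 2" by (simp add: hidden_dist_def)
  moreover have "1 \<le> hidden_dist T gr c u v" if "u \<noteq> v" for u v
    using that by (simp add: hidden_dist_def)
  from this[of x y] this[of y z]
  have "2 \<le> hidden_dist T gr c x y + hidden_dist T gr c y z" if "x \<noteq> y" "y \<noteq> z"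
    using that by simp
  moreover have "hidden_dist T gr c u u = 0" for u by (simp add: hidden_dist_def)
  ultimately show "hidden_dist T gr c x z \<le> hidden_dist T gr c x y + hidden_dist T gr c y z"
    by (cases "x = y"; cases "y = z") auto
  show "hidden_dist T gr c x y = hidden_dist T gr c y x" by (rule hidden_dist_commute)
qed (simp_all add: hidden_dist_def)

text \<open>The witness is a star on the centres with root \<open>c 0\<close> and edges of length at
  most 2, from which every terminal hangs at its own centre by an edge of length 1.\<close>

lemma ST_hidden_dist_le:
  assumes V: "finite V" and TV: "T \<subseteq> V" and T: "T \<noteq> {}"
    and gr: "gr ` T \<subseteq> {..<g}" and c: "c ` {..<g} \<subseteq> V"
  shows "ST V T (hidden_dist T gr c) \<le> card T + 2 * real g"
proof -
  let ?w = "hidden_dist T gr c" and ?C = "c ` {..<g}"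
  have g: "0 < g" using T gr by auto
  have finT: "finite T" using V TV finite_subset by blast
  have w2: "?w u v \<le> 2" for u v by (simp add: hidden_dist_def)
  have w1: "?w (c (gr t)) t \<le> 1" if "t \<in> T" for t using that by (simp add: hidden_dist_def)
  obtain E where E: "is_tree ({c 0} \<union> ?C, E)" "cost ?w ({c 0} \<union> ?C, E) \<le> 2 * card ?C"
    using tree_extend[OF is_tree_singleton[of "c 0"], where X = ?C and r = "\<lambda>_. c 0" and w = ?w
        and b = 2, OF _ _ w2 _ hidden_dist_commute]
    by (auto simp: cost_def)
  have C: "{c 0} \<union> ?C = ?C" using g by auto
  have "c (gr t) \<in> ?C" if "t \<in> T" for t using gr that by auto
  then obtain F where F: "is_tree (?C \<union> T, F)" "cost ?w (?C \<union> T, F) \<le> cost ?w (?C, E) + 1 * card T"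
    using tree_extend[OF E(1)[unfolded C] finT, where r = "\<lambda>t. c (gr t)" and w = ?w and b = 1,
        OF _ w1 _ hidden_dist_commute]
    by auto
  have "ST V T ?w \<le> cost ?w (?C \<union> T, F)"
    using F TV c by (intro ST_le V) (auto simp: steiner_tree_def)
  moreover have "card ?C \<le> g" using card_image_le[of "{..<g}" c] by simp
  ultimately show ?thesis using F(2) E(2)[unfolded C] by simp
qed

text \<open>An edge of length 1 joins a terminal to the centre of its group, so each centre that \<open>G\<close> hits
  saves at most \<open>D\<close>.\<close>

lemma cost_hidden_dist_ge:
  assumes G: "steiner_tree V T G" and T: "T \<noteq> {}" and gr: "gr ` T \<subseteq> {..<g}"
    and D: "\<And>i. i < g \<Longrightarrow> card {t\<in>T. gr t = i} \<le> D"
  shows "2 * (real (card T) - 1)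
      - D * real (card {i. i < g \<and> (\<exists>u\<in>{t\<in>T. gr t = i}. (u, c i) \<in> snd G)})
    \<le> cost (hidden_dist T gr c) G"
proof -
  let ?w = "hidden_dist T gr c" and ?I = "{i. i < g \<and> (\<exists>u\<in>{t\<in>T. gr t = i}. (u, c i) \<in> snd G)}"
  have s: "simple_graph G" "connected_graph G" and TG: "T \<subseteq> fst G"
    using G by (auto simp: steiner_tree_def is_tree_def)
  have fin: "finite (fst G)" and EW: "snd G \<subseteq> fst G \<times> fst G" and sy: "sym (snd G)"
    and ir: "irrefl (snd G)" using s by (auto simp: simple_graph_def)
  have finT: "finite T" using TG fin finite_subset by blast
  have finE: "finite (snd G)" using fin EW by (meson finite_SigmaI finite_subset)
  \<comment> \<open>\<open>A\<close> holds the edges of length 1, oriented from the terminal to its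
    centre. Such an edge is determined by its terminal, so \<open>A\<close> is no larger than the
    union of the groups that are hit.\<close>
  define A where "A = {e \<in> snd G. fst e \<in> T \<and> snd e = c (gr (fst e))}"
  have A: "A \<subseteq> snd G" "finite A" using finE by (auto simp: A_def)
  have "A \<subseteq> (\<lambda>u. (u, c (gr u))) ` (\<Union>i\<in>?I. {t\<in>T. gr t = i})"
  proof
    fix e assume e: "e \<in> A"
    then have "fst e \<in> T" "e = (fst e, c (gr (fst e)))" "e \<in> snd G" by (auto simp: A_def prod_eq_iff)
    moreover from this have "gr (fst e) \<in> ?I" using gr by auto
    ultimately show "e \<in> (\<lambda>u. (u, c (gr u))) ` (\<Union>i\<in>?I. {t\<in>T. gr t = i})" by blast
  qed
  then have "card A \<le> card (\<Union>i\<in>?I. {t\<in>T. gr t = i})"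
    using finT by (intro surj_card_le) auto
  also have "\<dots> \<le> (\<Sum>i\<in>?I. card {t\<in>T. gr t = i})" by (rule card_UN_le) auto
  also have "\<dots> \<le> (\<Sum>i\<in>?I. D)" using D by (intro sum_mono) auto
  finally have cA: "card A \<le> D * card ?I" by (simp add: mult.commute)
  \<comment> \<open>An oriented edge of length 1 lies in \<open>A\<close> or in its converse, so
    subtracting both indicators from 2 bounds the length from below.\<close>
  let ?i = "\<lambda>e. indicator A e + indicator (A\<inverse>) e :: real"
  have "(\<Sum>e\<in>snd G. 2 - ?i e) \<le> (\<Sum>(u, v)\<in>snd G. ?w u v)"
  proof (rule sum_mono)
    fix e assume e: "e \<in> snd G"
    obtain u v where uv: "e = (u, v)" by (cases e)
    have "u \<noteq> v" using e uv ir by (auto simp: irrefl_def)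
    moreover have "(v, u) \<in> snd G" using e uv sy by (auto dest: symD)
    ultimately show "2 - ?i e \<le> (case e of (u, v) \<Rightarrow> ?w u v)"
      using e uv by (auto simp: A_def hidden_dist_def indicator_def)
  qed
  moreover have "(\<Sum>e\<in>snd G. indicator A e) = real (card A)"
    using A finE by (simp add: indicator_def of_bool_def sum.If_cases Int_absorb1)
  moreover have "(\<Sum>e\<in>snd G. indicator (A\<inverse>) e) = real (card A)"
  proof -
    have "A\<inverse> \<subseteq> snd G" using A(1) sy by (auto dest: symD)
    then show ?thesis
      using A finE by (simp add: indicator_def of_bool_def sum.If_cases Int_absorb1 card_inverse)
  qed
  ultimately have "2 * real (card (snd G)) - 2 * card A \<le> 2 * cost ?w G"
    by (simp add: cost_def sum_subtractf sum.distrib)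
  moreover have "2 * (card T - 1) \<le> card (snd G)"
    using connected_graph_card_edges[OF s] card_mono[OF fin TG] by linarith
  moreover have "0 < card T" using T finT by (simp add: card_gt_0_iff)
  moreover have "real (card A) \<le> D * real (card ?I)" using of_nat_mono[OF cA] by simp
  ultimately show ?thesis by (simp add: of_nat_diff)
qed

text \<open>Every edge has length at least 1. Hence a cheap output is small enough for its edges to
  count as probes.\<close>

lemma card_edges_le_cost_hidden_dist:
  assumes "simple_graph G"
  shows "card (snd G) \<le> 2 * cost (hidden_dist T gr c) G"
proof -
  have "(\<Sum>e\<in>snd G. 1) \<le> (\<Sum>(u, v)\<in>snd G. hidden_dist T gr c u v)"
    using assms by (intro sum_mono) (auto simp: simple_graph_def irrefl_def hidden_dist_def)
  then show ?thesis by (simp add: cost_def)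
qed

section \<open>Searching for the centres\<close>

text \<open>
  The edges of a small output count as if they had been queried, so that an edge of length 1 in the
  output was probed as well. A large output is too expensive and contributes no probes.
\<close>

primrec probes :: "nat \<Rightarrow> ('a \<Rightarrow> 'a \<Rightarrow> real) \<Rightarrow> 'a algorithm \<Rightarrow> ('a \<times> 'a) multiset" where
  "probes L w (Output G) = (if card (snd G) \<le> L then mset_set (snd G) else {#})"
| "probes L w (Query u v f) = {#(u, v), (v, u)#} + probes L w (f (w u v))"

lemma size_probes_le: "size (probes L w A) \<le> 2 * num_queries w A + L"
  by (induction A) auto

lemma output_subset_probes:
  assumes "finite (snd (alg_output w A))" "card (snd (alg_output w A)) \<le> L"
  shows "snd (alg_output w A) \<subseteq> set_mset (probes L w A)"
  using assms
proof (induction A)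
  case (Query u v f)
  then have "snd (alg_output w (f (w u v))) \<subseteq> set_mset (probes L w (f (w u v)))" by simp
  then show ?case by auto
qed simp

text \<open>
  One hidden element \<open>x\<close> of \<open>S\<close>: all runs that have not found \<open>x\<close> yet coincide, so each probe
  excludes at most one candidate, and the excluded candidates are found on average halfway.
\<close>

lemma hidden_search:
  fixes w :: "'a \<Rightarrow> 'a \<Rightarrow> 'a \<Rightarrow> real"
  assumes "finite S"
    and "\<And>u v x y. x \<in> S \<Longrightarrow> y \<in> S \<Longrightarrow> \<not> (u \<in> P \<and> v = x \<or> v \<in> P \<and> u = x) \<Longrightarrow>
        \<not> (u \<in> P \<and> v = y \<or> v \<in> P \<and> u = y) \<Longrightarrow> w x u v = w y u v"
  shows "card S * card {x\<in>S. \<exists>u\<in>P. (u, x) \<in># probes L (w x) A}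
    \<le> 2 * (\<Sum>x\<in>S. size {#e \<in># probes L (w x) A. fst e \<in> P#})"
  using assms
proof (induction A arbitrary: S)
  case (Output G)
  \<comment> \<open>Finiteness is part of the condition because an infinite set has
    \<open>card\<close> 0 and its \<open>mset_set\<close> is empty.\<close>
  define E where "E = (if card (snd G) \<le> L \<and> finite (snd G) then snd G else {})"
  have pr: "probes L w' (Output G) = mset_set E" for w' by (auto simp: E_def)
  have finE: "finite E" by (auto simp: E_def)
  \<comment> \<open>The output is the same for all candidates, and each of its probes from
    \<open>P\<close> names a single one. So the number found is at most the number of probes that
    every candidate pays for.\<close>
  have "{x\<in>S. \<exists>u\<in>P. (u, x) \<in># mset_set E} \<subseteq> snd ` {e\<in>E. fst e \<in> P}"
    using finE by force
  then have "card {x\<in>S. \<exists>u\<in>P. (u, x) \<in># mset_set E} \<le> card {e\<in>E. fst e \<in> P}"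
    using finE by (intro surj_card_le) auto
  also have "\<dots> = size {#e \<in># mset_set E. fst e \<in> P#}"
    using finE by (simp only: filter_mset_mset_set size_mset_set)
  finally show ?case unfolding pr by simp
next
  case (Query u v f)
  define hit where "hit x \<longleftrightarrow> u \<in> P \<and> v = x \<or> v \<in> P \<and> u = x" for x
  \<comment> \<open>\<open>a\<close> counts the probes from \<open>P\<close> made by this query, and
    \<open>Q\<close> collects the candidates it hits.\<close>
  define a where "a = (of_bool (u \<in> P) + of_bool (v \<in> P) :: nat)"
  define Q where "Q = {x\<in>S. hit x}"
  define S' where "S' = S - Q"
  define N where "N x = size {#e \<in># probes L (w x) (f (w x u v)). fst e \<in> P#}" for x
  define found where "found x \<longleftrightarrow> (\<exists>u'\<in>P. (u', x) \<in># probes L (w x) (f (w x u v)))" for x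
  have "Q \<subseteq> (if u \<in> P then {v} else {}) \<union> (if v \<in> P then {u} else {})"
    by (auto simp: Q_def hit_def)
  then have "card Q \<le> card ((if u \<in> P then {v} else {}) \<union> (if v \<in> P then {u} else {}))"
    by (intro card_mono) auto
  also have "\<dots> \<le> a" unfolding a_def by (auto intro: order_trans[OF card_insert_le_m1])
  finally have Qa: "card Q \<le> a" .
  have cS: "card S = card Q + card S'"
    unfolding S'_def using Query.prems(1) by (simp add: Q_def card_Diff_subset card_mono)
  have IH: "card S' * card {x\<in>S'. found x} \<le> 2 * (\<Sum>x\<in>S'. N x)"
  proof (cases "S' = {}")
    case False
    then obtain z where z: "z \<in> S'" by blast
    \<comment> \<open>Candidates that are not hit give the same answer, so their runs enter one
      common subtree, to which the induction hypothesis for \<open>S'\<close> applies.\<close>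
    have same: "w x u v = w z u v" if "x \<in> S'" for x
      using that z Query.prems(2)[of x z u v] by (auto simp: S'_def Q_def hit_def)
    have "card S' * card {x\<in>S'. \<exists>u'\<in>P. (u', x) \<in># probes L (w x) (f (w z u v))}
      \<le> 2 * (\<Sum>x\<in>S'. size {#e \<in># probes L (w x) (f (w z u v)). fst e \<in> P#})"
      using Query.prems by (intro Query.IH) (auto simp: S'_def)
    moreover have "{x\<in>S'. \<exists>u'\<in>P. (u', x) \<in># probes L (w x) (f (w z u v))} = {x\<in>S'. found x}"
      using same by (auto simp: found_def)
    moreover have "(\<Sum>x\<in>S'. size {#e \<in># probes L (w x) (f (w z u v)). fst e \<in> P#}) = (\<Sum>x\<in>S'. N x)"
      using same by (intro sum.cong) (auto simp: N_def)
    ultimately show ?thesis by simp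
  qed simp
  define M where "M = card {x\<in>S'. found x}"
  have MS: "M \<le> card S"
    unfolding M_def using Query.prems(1) by (intro card_mono) (auto simp: S'_def)
  have "{x\<in>S. \<exists>u'\<in>P. (u', x) \<in># probes L (w x) (Query u v f)} \<subseteq> Q \<union> {x\<in>S'. found x}"
    by (auto simp: found_def S'_def Q_def hit_def)
  then have "card {x\<in>S. \<exists>u'\<in>P. (u', x) \<in># probes L (w x) (Query u v f)}
      \<le> card (Q \<union> {x\<in>S'. found x})"
    using Query.prems(1) by (intro card_mono) (auto simp: Q_def S'_def)
  also have "\<dots> \<le> card Q + M" unfolding M_def by (rule card_Un_le)
  finally have "card S * card {x\<in>S. \<exists>u'\<in>P. (u', x) \<in># probes L (w x) (Query u v f)}
      \<le> card S * (card Q + M)" by simp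
  \<comment> \<open>The query is charged twice, which is the origin of the factor 2: once for
    finding \<open>Q\<close> and once for shrinking \<open>S\<close> to \<open>S'\<close>. Each
    charge is at most \<open>a * card S\<close>.\<close>
  also have "\<dots> = card S * card Q + card Q * M + card S' * M"
    by (simp add: cS algebra_simps)
  also have "\<dots> \<le> card S * a + a * card S + 2 * (\<Sum>x\<in>S'. N x)"
    using mult_le_mono2[OF Qa, of "card S"] mult_le_mono[OF Qa MS] IH unfolding M_def by linarith
  also have "\<dots> \<le> 2 * (\<Sum>x\<in>S. a + N x)"
  proof -
    have "(\<Sum>x\<in>S'. N x) \<le> (\<Sum>x\<in>S. N x)"
      using Query.prems(1) by (intro sum_mono2) (auto simp: S'_def)
    then show ?thesis by (simp add: sum.distrib)
  qed
  also have "(\<Sum>x\<in>S. a + N x) = (\<Sum>x\<in>S. size {#e \<in># probes L (w x) (Query u v f). fst e \<in> P#})"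
    by (intro sum.cong) (auto simp: a_def N_def)
  finally show ?case .
qed

text \<open>Resampling one coordinate preserves the uniform distribution: exchanging
  \<open>c i\<close> with \<open>x\<close> is an involution on the pairs
  \<open>(c, x)\<close>.\<close>

lemma sum_PiE_fun_upd:
  fixes F :: "('i \<Rightarrow> 'a) \<Rightarrow> nat"
  assumes i: "i \<in> I"
  shows "(\<Sum>c\<in>I \<rightarrow>\<^sub>E V. \<Sum>x\<in>V. F (c(i := x))) = card V * (\<Sum>c\<in>I \<rightarrow>\<^sub>E V. F c)"
proof -
  have "(\<Sum>(c, x)\<in>(I \<rightarrow>\<^sub>E V) \<times> V. F (c(i := x))) = (\<Sum>(c, x)\<in>(I \<rightarrow>\<^sub>E V) \<times> V. F c)"
    by (rule sum.reindex_bij_witness[where i = "\<lambda>(c, x). (c(i := x), c i)"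
          and j = "\<lambda>(c, x). (c(i := x), c i)"])
      (use i in \<open>auto simp: PiE_iff extensional_def\<close>)
  then show ?thesis
    by (simp add: sum.cartesian_product[symmetric] sum_distrib_left)
qed

text \<open>With all other centres fixed, \<open>hidden_search\<close> applies to the centre of
  group \<open>i\<close>, whose candidates are all of \<open>V\<close>. Resampling then averages
  over the fixed centres.\<close>

lemma sum_found_centres_le:
  fixes gr :: "'a \<Rightarrow> nat" and T :: "'a set"
  assumes V: "finite V" "V \<noteq> {}" and i: "i < g"
  defines "P \<equiv> {t\<in>T. gr t = i}"
  shows "card V * (\<Sum>c\<in>{..<g} \<rightarrow>\<^sub>E V. of_bool (\<exists>u\<in>P. (u, c i) \<in># probes L (hidden_dist T gr c) A))
    \<le> 2 * (\<Sum>c\<in>{..<g} \<rightarrow>\<^sub>E V. size {#e \<in># probes L (hidden_dist T gr c) A. fst e \<in> P#})"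
    (is "_ * sum ?F ?C \<le> 2 * sum ?N ?C")
proof -
  have "card V * (\<Sum>x\<in>V. ?F (c(i := x))) \<le> 2 * (\<Sum>x\<in>V. ?N (c(i := x)))" for c
  proof -
    have "(\<Sum>x\<in>V. ?F (c(i := x)))
        = card {x\<in>V. \<exists>u\<in>P. (u, x) \<in># probes L (hidden_dist T gr (c(i := x))) A}"
      using V(1) by (simp add: of_bool_def sum.If_cases Int_def)
    \<comment> \<open>Moving the centre of group \<open>i\<close> affects only pairs of an element
      of \<open>P\<close> and the old or new centre.\<close>
    moreover have "hidden_dist T gr (c(i := x)) u v = hidden_dist T gr (c(i := y)) u v"
      if "\<not> (u \<in> P \<and> v = x \<or> v \<in> P \<and> u = x)" "\<not> (u \<in> P \<and> v = y \<or> v \<in> P \<and> u = y)" for u v x y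
      using that by (auto simp: hidden_dist_def P_def)
    from hidden_search[where w = "\<lambda>x. hidden_dist T gr (c(i := x))" and L = L and A = A, OF V(1) this]
    have "card V * card {x\<in>V. \<exists>u\<in>P. (u, x) \<in># probes L (hidden_dist T gr (c(i := x))) A}
        \<le> 2 * (\<Sum>x\<in>V. ?N (c(i := x)))" .
    ultimately show ?thesis by (simp only:)
  qed
  then have "(\<Sum>c\<in>?C. card V * (\<Sum>x\<in>V. ?F (c(i := x)))) \<le> (\<Sum>c\<in>?C. 2 * (\<Sum>x\<in>V. ?N (c(i := x))))"
    by (intro sum_mono)
  then have "card V * (\<Sum>c\<in>?C. \<Sum>x\<in>V. ?F (c(i := x))) \<le> 2 * (\<Sum>c\<in>?C. \<Sum>x\<in>V. ?N (c(i := x)))"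
    by (simp only: sum_distrib_left)
  then have "card V * (card V * sum ?F ?C) \<le> 2 * (card V * sum ?N ?C)"
    using i by (simp only: sum_PiE_fun_upd[of i "{..<g}" ?F V] sum_PiE_fun_upd[of i "{..<g}" ?N V] lessThan_iff)
  then have "card V * (card V * sum ?F ?C) \<le> card V * (2 * sum ?N ?C)"
    by (simp only: mult.left_commute)
  then show ?thesis using V by (simp only: mult_le_cancel1 card_gt_0_iff) auto
qed

text \<open>Summing the bound for one centre over all groups counts each probe at most once, since
  its first component belongs to at most one group.\<close>

lemma sum_card_found_centres_le:
  fixes q :: real
  assumes V: "finite V" "V \<noteq> {}"
    and q: "\<And>c. c \<in> {..<g} \<rightarrow>\<^sub>E V \<Longrightarrow> real (num_queries (hidden_dist T gr c) A) \<le> q"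
  shows "card V * (\<Sum>c\<in>{..<g} \<rightarrow>\<^sub>E V. real (card {i. i < g \<and>
        (\<exists>u\<in>{t\<in>T. gr t = i}. (u, c i) \<in># probes L (hidden_dist T gr c) A)}))
    \<le> 2 * (card ({..<g} \<rightarrow>\<^sub>E V) * (2 * q + L))"
    (is "_ * (\<Sum>c\<in>?C. real (card (?I c))) \<le> _")
proof -
  let ?P = "\<lambda>i. {t\<in>T. gr t = i}" and ?pr = "\<lambda>c. probes L (hidden_dist T gr c) A"
  have N: "(\<Sum>i<g. size {#e \<in># M. fst e \<in> ?P i#}) \<le> size M" for M :: "('a \<times> 'a) multiset"
  proof (induction M)
    case (add e M)
    have "(\<Sum>i<g. of_bool (fst e \<in> ?P i)) \<le> (1::nat)"
    proof -
      have "(\<Sum>i<g. of_bool (fst e \<in> ?P i)) \<le> (\<Sum>i<g. of_bool (i = gr (fst e)) :: nat)"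
        by (intro sum_mono) auto
      also have "\<dots> \<le> 1" by (simp add: of_bool_def)
      finally show ?thesis .
    qed
    moreover have "(\<Sum>i<g. size {#x \<in># add_mset e M. fst x \<in> ?P i#})
        = (\<Sum>i<g. of_bool (fst e \<in> ?P i)) + (\<Sum>i<g. size {#x \<in># M. fst x \<in> ?P i#})"
      unfolding sum.distrib[symmetric] by (intro sum.cong) auto
    ultimately show ?case using add by simp
  qed simp
  have "card (?I c) = (\<Sum>i<g. of_bool (\<exists>u\<in>?P i. (u, c i) \<in># ?pr c))" for c
    by (simp add: of_bool_def sum.If_cases Int_def)
  then have "card V * (\<Sum>c\<in>?C. card (?I c))
      = (\<Sum>i<g. card V * (\<Sum>c\<in>?C. of_bool (\<exists>u\<in>?P i. (u, c i) \<in># ?pr c)))"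
    by (simp add: sum_distrib_left[symmetric] sum.swap[of _ ?C])
  also have "\<dots> \<le> (\<Sum>i<g. 2 * (\<Sum>c\<in>?C. size {#e \<in># ?pr c. fst e \<in> ?P i#}))"
    using sum_found_centres_le[OF V] by (intro sum_mono) auto
  also have "\<dots> = 2 * (\<Sum>c\<in>?C. \<Sum>i<g. size {#e \<in># ?pr c. fst e \<in> ?P i#})"
    by (simp add: sum_distrib_left[symmetric] sum.swap[of _ ?C])
  also have "\<dots> \<le> 2 * (\<Sum>c\<in>?C. size (?pr c))" using N by (intro mult_left_mono sum_mono) auto
  finally have "real (card V * (\<Sum>c\<in>?C. card (?I c))) \<le> real (2 * (\<Sum>c\<in>?C. size (?pr c)))"
    by (simp only: of_nat_le_iff)
  moreover have "(\<Sum>c\<in>?C. real (size (?pr c))) \<le> (\<Sum>c\<in>?C. 2 * q + L)"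
  proof (rule sum_mono)
    fix c assume "c \<in> ?C"
    then show "real (size (?pr c)) \<le> 2 * q + L"
      using q[of c] size_probes_le[of L "hidden_dist T gr c" A] by linarith
  qed
  ultimately show ?thesis by simp
qed

section \<open>The lower bound\<close>

text \<open>An enumeration of \<open>T\<close> is cut into blocks of length \<open>D\<close>; the
  additional index is for an incomplete last block.\<close>

lemma balanced_groups:
  assumes "finite T" "0 < D"
  obtains gr :: "'a \<Rightarrow> nat" where "gr ` T \<subseteq> {..<card T div D + 1}"
    "\<And>i. card {t\<in>T. gr t = i} \<le> D"
proof -
  obtain h where h: "bij_betw h T {..<card T}"
    using ex_bij_betw_finite_nat[OF assms(1)] by (auto simp: atLeast0LessThan)
  have "card {t\<in>T. h t div D = i} \<le> D" for i
  proof -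
    have "m div D * D \<le> m \<and> m < m div D * D + D" for m
      using dividend_less_div_times[OF assms(2), of m] by (simp add: add.commute)
    then have "h ` {t\<in>T. h t div D = i} \<subseteq> {i * D..<i * D + D}" by auto
    then have "card (h ` {t\<in>T. h t div D = i}) \<le> D"
      using card_mono[of "{i * D..<i * D + D}" "h ` {t\<in>T. h t div D = i}"] by simp
    moreover have "inj_on h {t\<in>T. h t div D = i}"
      using h by (auto simp: bij_betw_def inj_on_def)
    ultimately show ?thesis by (simp add: card_image)
  qed
  moreover have "h t div D < card T div D + 1" if "t \<in> T" for t
  proof -
    have "h t \<le> card T" using h that by (auto simp: bij_betw_def intro: less_imp_le)
    then show ?thesis by (simp add: div_le_mono less_Suc_eq_le)
  qed
  ultimately show thesis using that[of "\<lambda>t. h t div D"] by auto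
qed

text \<open>Markov's inequality in counting form: each success finds at least
  \<open>\<epsilon> * k / (4 * D)\<close> centres, while the average over all \<open>c\<close> is at
  most \<open>p * \<epsilon> * k / (8 * D)\<close>.\<close>

lemma success_count_le:
  fixes \<epsilon> p q :: real and T V :: "'a set"
  defines "k \<equiv> card T"
  assumes eps: "0 < \<epsilon>" "\<epsilon> < 1" and p: "0 < p" "p \<le> 1"
    and V: "finite V" and TV: "T \<subseteq> V"
    and D: "8 / \<epsilon> \<le> real D" and k: "640 * real D / (p * \<epsilon>) \<le> real k"
    and gr: "gr ` T \<subseteq> {..<k div D + 1}" "\<And>i. card {t\<in>T. gr t = i} \<le> D"
    and q: "q \<le> p * \<epsilon> / (64 * D) * card V * k"
    and A: "\<And>c. c \<in> {..<k div D + 1} \<rightarrow>\<^sub>E V \<Longrightarrow> real (num_queries (hidden_dist T gr c) A) \<le> q"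
  shows "real (card {c \<in> {..<k div D + 1} \<rightarrow>\<^sub>E V. approx_steiner_tree (2 - \<epsilon>) V T
      (hidden_dist T gr c) (alg_output (hidden_dist T gr c) A)})
    \<le> p / 2 * card ({..<k div D + 1} \<rightarrow>\<^sub>E V)"
proof -
  define g where "g = k div D + 1"
  define n where "n = card V"
  \<comment> \<open>A successful output costs at most \<open>2 * (k + 2 * g)\<close>, hence has at
    most twice as many oriented edges.\<close>
  define L where "L = 4 * (k + 2 * g)"
  let ?C = "{..<g} \<rightarrow>\<^sub>E V" and ?w = "hidden_dist T gr"
  let ?I = "\<lambda>c. {i. i < g \<and> (\<exists>u\<in>{t\<in>T. gr t = i}. (u, c i) \<in># probes L (?w c) A)}"
  define S where "S = {c \<in> ?C. approx_steiner_tree (2 - \<epsilon>) V T (?w c) (alg_output (?w c) A)}"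
  have finC: "finite ?C" using V by (intro finite_PiE) auto
  have D8: "8 \<le> \<epsilon> * D" using D eps by (simp add: field_simps)
  have D1: "8 \<le> real D" using D8 eps
    by (smt (verit) mult_left_le_one_le of_nat_0_le_iff)
  have pe: "0 < p * \<epsilon>" "p * \<epsilon> \<le> \<epsilon>" "p * \<epsilon> \<le> 1"
    using p eps by (auto simp: mult_le_one mult_left_le_one_le)
  have kD: "640 * D \<le> k * (p * \<epsilon>)" using k pe by (simp add: pos_divide_le_eq)
  have ke: "24 \<le> \<epsilon> * k"
  proof -
    have "k * (p * \<epsilon>) \<le> k * \<epsilon>" using pe by (intro mult_left_mono) auto
    then show ?thesis using kD D1 by (simp add: mult.commute)
  qed
  have k1: "24 \<le> real k" using ke eps by (smt (verit) mult_left_le_one_le of_nat_0_le_iff)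
  have T: "T \<noteq> {}" using k1 by (auto simp: k_def)
  have kn: "k \<le> n" unfolding k_def n_def using V TV by (rule card_mono)
  have V0: "V \<noteq> {}" using T TV by auto
  have g: "real g \<le> k / D + 1"
    unfolding g_def using of_nat_div_le_of_nat[of k D] by simp
  \<comment> \<open>Of the gap \<open>\<epsilon> * k\<close> between the two cost bounds, joining
    the centres takes at most half by the choice of \<open>D\<close>, and the additive constant 6 at
    most a quarter because \<open>24 \<le> \<epsilon> * k\<close>. The last quarter must come from
    edges to centres.\<close>
  have found: "\<epsilon> * k / (4 * D) \<le> card (?I c)" if c: "c \<in> S" for c
  proof -
    let ?G = "alg_output (?w c) A"
    let ?J = "{i. i < g \<and> (\<exists>u\<in>{t\<in>T. gr t = i}. (u, c i) \<in> snd ?G)}"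
    have cC: "c ` {..<g} \<subseteq> V" using c by (auto simp: S_def)
    have G: "steiner_tree V T ?G" and cost: "cost (?w c) ?G \<le> (2 - \<epsilon>) * ST V T (?w c)"
      using c by (auto simp: S_def approx_steiner_tree_def)
    have "ST V T (?w c) \<le> k + 2 * real g"
      unfolding k_def using ST_hidden_dist_le[OF V TV T _ cC] gr(1) by (simp add: g_def)
    then have cost': "cost (?w c) ?G \<le> (2 - \<epsilon>) * (k + 2 * real g)"
      using cost eps by (smt (verit) mult_left_mono)
    have s: "simple_graph ?G" using G by (auto simp: steiner_tree_def is_tree_def)
    have "(2 - \<epsilon>) * (k + 2 * real g) \<le> 2 * (k + 2 * real g)" using eps by (intro mult_right_mono) auto
    then have "real (card (snd ?G)) \<le> real L"
      using card_edges_le_cost_hidden_dist[OF s, of T gr c] cost' by (simp add: L_def)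
    then have "snd ?G \<subseteq> set_mset (probes L (?w c) A)"
      using s by (intro output_subset_probes)
        (auto simp: simple_graph_def intro: finite_subset)
    then have JI: "card ?J \<le> card (?I c)" by (intro card_mono) auto
    have "2 * (real k - 1) - D * real (card ?J) \<le> (2 - \<epsilon>) * (k + 2 * real g)"
      using cost_hidden_dist_ge[OF G T, of gr g D c] gr cost' by (simp add: k_def g_def)
    also have "\<dots> \<le> (2 - \<epsilon>) * (k + 2 * (k / D + 1))" using g eps by (intro mult_left_mono) auto
    also have "\<dots> = (2 - \<epsilon>) * k + (2 - \<epsilon>) * (2 * (k / D + 1))" by (simp add: algebra_simps)
    also have "\<dots> \<le> (2 - \<epsilon>) * k + 2 * (2 * (k / D + 1))"
      using eps by (intro add_left_mono mult_right_mono) auto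
    finally have "\<epsilon> * k - 4 * (k / D) - 6 \<le> D * real (card ?J)" by (simp add: algebra_simps)
    moreover have "8 * (k / D) \<le> \<epsilon> * k"
    proof -
      have "8 * real k \<le> \<epsilon> * D * k" using D8 by (intro mult_right_mono) auto
      then show ?thesis using D1 by (simp add: field_simps)
    qed
    ultimately have "\<epsilon> * k / 4 \<le> D * real (card ?J)" using ke by simp
    also have "\<dots> \<le> D * real (card (?I c))" using JI by (intro mult_left_mono) auto
    finally show ?thesis using D1 by (simp add: field_simps)
  qed
  have "real n * (card S * (\<epsilon> * k / (4 * D))) = n * (\<Sum>c\<in>S. \<epsilon> * k / (4 * D))" by simp
  also have "\<dots> \<le> n * (\<Sum>c\<in>S. real (card (?I c)))"
    using found by (intro mult_left_mono sum_mono) auto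
  also have "\<dots> \<le> n * (\<Sum>c\<in>?C. real (card (?I c)))"
    using finC by (intro mult_left_mono sum_mono2) (auto simp: S_def)
  also have "\<dots> \<le> 2 * (card ?C * (2 * q + L))"
    unfolding n_def using A by (intro sum_card_found_centres_le V V0) (auto simp: g_def)
  also have "\<dots> \<le> 2 * (card ?C * (n * (p * \<epsilon> * k / (16 * D))))"
  proof -
    \<comment> \<open>Queries and output edges each get half of the probe budget. For the output
      this needs \<open>20 * 32 * D \<le> p * \<epsilon> * n\<close>, the source of the constant
      640.\<close>
    have "real L \<le> 20 * k"
    proof -
      have "k / D \<le> real k" using D1 mult_left_mono[of 1 "real D" "real k"] by (simp add: divide_le_eq)
      then show ?thesis using g k1 by (simp add: L_def)
    qed
    also have "20 * k \<le> n * (p * \<epsilon> * k / (32 * D))"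
    proof -
      have "k * (p * \<epsilon>) \<le> n * (p * \<epsilon>)" using kn pe by (intro mult_right_mono) auto
      then have "real (640 * D) * real k \<le> n * (p * \<epsilon>) * k"
        using kD by (intro mult_right_mono) auto
      then show ?thesis using D1 by (simp add: field_simps)
    qed
    finally have "2 * q + L \<le> n * (p * \<epsilon> * k / (16 * D))"
      using q D1 by (simp add: n_def field_simps)
    then show ?thesis by (intro mult_left_mono) auto
  qed
  also have "\<dots> = real n * (p / 2 * card ?C * (\<epsilon> * k / (4 * D)))" by simp
  finally have "real n * (card S * (\<epsilon> * k / (4 * D))) \<le> real n * (p / 2 * card ?C * (\<epsilon> * k / (4 * D)))" .
  moreover have "0 < real n" "0 < \<epsilon> * k / (4 * D)" using k1 kn eps D1 by auto
  ultimately have "card S \<le> p / 2 * card ?C" by (simp only: mult_le_cancel_left_pos mult_le_cancel_right_pos)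
  then show ?thesis by (simp add: S_def g_def)
qed

text \<open>The expected number of instances in \<open>C\<close> that are solved is computed in two
  ways. The guarantee for each instance gives at least \<open>p * card C\<close>; if the query bound
  failed, almost every deterministic algorithm would use fewer than \<open>q\<close> queries on all
  of \<open>C\<close> and solve at most \<open>r * card C\<close>.\<close>

lemma yao_averaging:
  fixes p q r :: real and w :: "'c \<Rightarrow> 'a \<Rightarrow> 'a \<Rightarrow> real"
  assumes R: "randomized_algorithm V R" and comp: "computes_approx_steiner_tree p \<beta> V T R"
    and C: "finite C" "C \<noteq> {}" and w: "\<And>c. c \<in> C \<Longrightarrow> Metric_space V (w c)"
    and det: "\<And>A. (\<And>c. c \<in> C \<Longrightarrow> real (num_queries (w c) A) \<le> q) \<Longrightarrow>
      real (card {c\<in>C. approx_steiner_tree \<beta> V T (w c) (alg_output (w c) A)}) \<le> r * card C"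
    and r: "r < p"
  shows "worst_case_queries_ge V R q"
proof (rule ccontr)
  assume neg: "\<not> worst_case_queries_ge V R q"
  interpret prob_space R using R by (simp add: randomized_algorithm_def)
  let ?ok = "\<lambda>c A. approx_steiner_tree \<beta> V T (w c) (alg_output (w c) A)"
  have meas: "{A \<in> space R. Q (alg_output (w c) A) (num_queries (w c) A)} \<in> sets R"
    if "c \<in> C" for Q c
  proof -
    have "(\<lambda>A. (alg_output (w c) A, num_queries (w c) A)) \<in> measurable R (count_space UNIV)"
      using R w[OF that] by (simp add: randomized_algorithm_def)
    from measurable_sets[OF this, of "{(G, m). Q G m}"] show ?thesis
      by (simp add: vimage_def Int_def conj_commute)
  qed
  have ok: "{A \<in> space R. ?ok c A} \<in> sets R" if "c \<in> C" for c
    using meas[OF that, of "\<lambda>G m. approx_steiner_tree \<beta> V T (w c) G"] .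
  have "AE A in R. \<not> q \<le> real (num_queries (w c) A)" if "c \<in> C" for c
  proof (rule AE_I)
    show "{A \<in> space R. \<not> \<not> q \<le> real (num_queries (w c) A)}
        \<subseteq> {A \<in> space R. q \<le> real (num_queries (w c) A)}" by auto
    have "measure R {A \<in> space R. q \<le> real (num_queries (w c) A)} = 0"
      using neg w[OF that] unfolding worst_case_queries_ge_def
      by (metis measure_nonneg less_eq_real_def)
    then show "emeasure R {A \<in> space R. q \<le> real (num_queries (w c) A)} = 0"
      by (simp add: emeasure_eq_measure)
  qed (rule meas[OF that])
  \<comment> \<open>Finiteness of \<open>C\<close> lets one null set serve all instances at once, so
    \<open>det\<close> applies to almost every \<open>A\<close>.\<close>
  then have AE: "AE A in R. \<forall>c\<in>C. \<not> q \<le> real (num_queries (w c) A)"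
    using C by (simp add: AE_finite_all)
  let ?X = "\<lambda>A. \<Sum>c\<in>C. indicator {A \<in> space R. ?ok c A} A :: real"
  have "p * card C = (\<Sum>c\<in>C. p)" by simp
  also have "\<dots> \<le> (\<Sum>c\<in>C. measure R {A \<in> space R. ?ok c A})"
    using comp w by (intro sum_mono) (auto simp: computes_approx_steiner_tree_def)
  also have "\<dots> = (\<Sum>c\<in>C. \<integral>A. indicator {A \<in> space R. ?ok c A} A \<partial>R)"
    using ok by (intro sum.cong) auto
  also have "\<dots> = (\<integral>A. ?X A \<partial>R)"
    using ok
    by (subst Bochner_Integration.integral_sum) (auto intro!: integrable_real_indicator simp: emeasure_eq_measure)
  also have "\<dots> \<le> (\<integral>A. r * card C \<partial>R)"
  proof (rule integral_mono_AE)
    show "integrable R ?X"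
      using ok by (intro Bochner_Integration.integrable_sum integrable_real_indicator) (auto simp: emeasure_eq_measure)
    show "AE A in R. ?X A \<le> r * card C"
      using AE AE_space
    proof eventually_elim
      case (elim A)
      have "?X A = (\<Sum>c\<in>C. of_bool (?ok c A))" using elim(2) by (intro sum.cong) auto
      also have "\<dots> = card {c\<in>C. ?ok c A}"
        using C(1) by (simp add: of_bool_def sum.If_cases Int_def)
      also have "\<dots> \<le> r * card C" using elim(1) by (intro det) auto
      finally show ?case .
    qed
  qed simp
  also have "\<dots> = r * card C" by (simp add: prob_space)
  finally show False using C r by (simp add: card_gt_0_iff)
qed

theorem theorem1p2:
  fixes \<epsilon> p :: real
  assumes "0 < \<epsilon>" and "\<epsilon> < 1 / 3"
    and "0 < p" and "p \<le> 1"
  shows "\<exists>c::real>0. \<exists>k0::nat. \<forall>(V::'a set) T R.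
           finite V \<and> T \<subseteq> V \<and> k0 \<le> card T \<and>
           randomized_algorithm V R \<and> computes_approx_steiner_tree p (2 - \<epsilon>) V T R \<longrightarrow>
           worst_case_queries_ge V R (c * real (card V) * real (card T))"
proof -
  \<comment> \<open>\<open>D\<close>, \<open>c\<close> and \<open>k0\<close> are what
    \<open>success_count_le\<close> requires; they depend only on \<epsilon> and \<open>p\<close>,
    so they may be chosen before \<open>V\<close>, \<open>T\<close> and \<open>R\<close>.\<close>
  define D where "D = nat \<lceil>8 / \<epsilon>\<rceil>"
  define c where "c = p * \<epsilon> / (64 * D)"
  define k0 where "k0 = nat \<lceil>640 * real D / (p * \<epsilon>)\<rceil>"
  have D: "8 / \<epsilon> \<le> real D" unfolding D_def by linarith
  have "0 < 8 / \<epsilon>" using assms by simp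
  then have D0: "0 < D" using D by (metis less_le_trans of_nat_0_less_iff)
  have c: "0 < c" using D0 assms by (simp add: c_def)
  have "worst_case_queries_ge V R (c * real (card V) * real (card T))"
    if "finite V" "T \<subseteq> V" "k0 \<le> card T" and R: "randomized_algorithm V R"
      "computes_approx_steiner_tree p (2 - \<epsilon>) V T R" for V T :: "'a set" and R
  proof -
    have k: "640 * real D / (p * \<epsilon>) \<le> real (card T)" using that(3) unfolding k0_def by linarith
    have "0 < 640 * real D / (p * \<epsilon>)" using D0 assms by simp
    then have "T \<noteq> {}" using k by auto
    have fT: "finite T" using that finite_subset by blast
    obtain gr :: "'a \<Rightarrow> nat" where gr: "gr ` T \<subseteq> {..<card T div D + 1}"
      "\<And>i. card {t\<in>T. gr t = i} \<le> D" using balanced_groups[OF fT D0] by blast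
    let ?C = "{..<card T div D + 1} \<rightarrow>\<^sub>E V"
    have "finite ?C" using that(1) by (intro finite_PiE) auto
    moreover have "?C \<noteq> {}" using \<open>T \<noteq> {}\<close> that(2) by (auto simp: PiE_eq_empty_iff)
    ultimately show ?thesis
    proof (rule yao_averaging[OF R, where w = "hidden_dist T gr" and r = "p / 2"])
      fix A assume "\<And>d. d \<in> ?C \<Longrightarrow>
        real (num_queries (hidden_dist T gr d) A) \<le> c * real (card V) * real (card T)"
      then show "real (card {d \<in> ?C. approx_steiner_tree (2 - \<epsilon>) V T (hidden_dist T gr d)
          (alg_output (hidden_dist T gr d) A)}) \<le> p / 2 * card ?C"
        using assms gr that by (intro success_count_le[OF _ _ _ _ _ _ D k]) (auto simp: c_def)
    qed (use assms Metric_space_hidden_dist in auto)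
  qed
  then show ?thesis using c by blast
qed

end
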